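(* Let $d\ge 1$, let $\Omega=(\mathbb{R}^{d})^{\mathbb{Z}}$, and let $\mathbb{P}$ be any shift-invariant (i.e. $T$-invariant) Borel probability measure on $\Omega$. Then the following assertions are equivalent: (a) The family $\{\mathbb{P}S_{n}^{-1}:n\ge 0\}$ of probability laws on $\mathbb{R}^{d}$ is tight. (b) $\mathbb{P}$ is null-homologous, i.e. there exists a $T$-invariant Borel probability measure $\mathbb{Q}$ on $\Omega$ such that $\mathbb{P}=\mathbb{Q}D^{-1}$.
   Context: $\Omega=(\mathbb{R}^{d})^{\mathbb{Z}}$ is the space of doubly infinite sequences $\mathbf{x}=(x_{n})_{n\in\mathbb{Z}}$ in $\mathbb{R}^d$ (product topology) with its Borel $\sigma$-field. $T:\Omega\to\Omega$ is the left shift, $(T\mathbf{x})_{n}=x_{n+1}$. A probability measure $\mathbb{P}$ on $\Omega$ is $T$-invariant if $\mathbb{P}T^{-1}=\mathbb{P}$. For $n\ge 1$, $S_{n}:\Omega\to\mathbb{R}^{d}$ is the map $S_{n}(\mathbf{x})=x_{1}+\ldots+x_{n}$, and $S_{0}=0$. The map $D:\Omega\to\Omega$ is $D(\mathbf{x})=T\mathbf{x}-\mathbf{x}$, i.e. $(D\mathbf{x})_{n}=x_{n+1}-x_{n}$. For a measurable map $F$ on $\Omega$, $\mathbb{P}F^{-1}$ denotes the image measure $\mathbb{P}(F\in\cdot)$. *)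

theory Defs
  imports "HOL-Probability.Probability"
begin

(* The sequence space is the type int \<Rightarrow> real ^ 'd. Its topology is the product topology
   (Function_Topology), so "borel" at this type is the Borel sigma-field of the product topology.
   The image measure of M under F is "distr M borel F". *)

definition borel_prob_measure :: "'a::topological_space measure \<Rightarrow> bool" where
  "borel_prob_measure M \<longleftrightarrow> prob_space M \<and> sets M = sets borel"

definition shift :: "(int \<Rightarrow> 'a) \<Rightarrow> (int \<Rightarrow> 'a)" where
  "shift x = (\<lambda>n. x (n + 1))"

definition shift_invariant :: "(int \<Rightarrow> real ^ 'd) measure \<Rightarrow> bool" where
  "shift_invariant M \<longleftrightarrow> distr M borel shift = M"

definition partial_sum :: "nat \<Rightarrow> (int \<Rightarrow> real ^ 'd) \<Rightarrow> real ^ 'd" where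
  "partial_sum n x = (\<Sum>k=1..n. x (int k))"

definition increments :: "(int \<Rightarrow> real ^ 'd) \<Rightarrow> (int \<Rightarrow> real ^ 'd)" where
  "increments x = (\<lambda>n. shift x n - x n)"

(* "distr" yields the image measure only for measurable maps; the three maps are even continuous. *)

lemma shift_measurable:
  "(shift :: (int \<Rightarrow> real ^ 'd) \<Rightarrow> (int \<Rightarrow> real ^ 'd)) \<in> borel_measurable borel"
  unfolding shift_def
  by (intro borel_measurable_continuous_onI continuous_on_coordinatewise_then_product
      continuous_on_product_coordinates)

lemma partial_sum_measurable:
  "(partial_sum n :: (int \<Rightarrow> real ^ 'd) \<Rightarrow> real ^ 'd) \<in> borel_measurable borel"
  unfolding partial_sum_def
  by (intro borel_measurable_continuous_onI continuous_on_sum continuous_on_product_coordinates)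

lemma increments_measurable:
  "(increments :: (int \<Rightarrow> real ^ 'd) \<Rightarrow> (int \<Rightarrow> real ^ 'd)) \<in> borel_measurable borel"
  unfolding increments_def shift_def
  by (intro borel_measurable_continuous_onI continuous_on_coordinatewise_then_product
      continuous_on_diff continuous_on_product_coordinates)

(* The constant "tight" of HOL-Probability is confined to sequences of laws on the real line. As
   there, the members are required to be probability laws. *)
definition tight_family :: "'a::t2_space measure set \<Rightarrow> bool" where
  "tight_family \<M> \<longleftrightarrow>
     (\<forall>\<mu>\<in>\<M>. borel_prob_measure \<mu>) \<and>
     (\<forall>\<epsilon>>0. \<exists>K. compact K \<and> (\<forall>\<mu>\<in>\<M>. measure \<mu> (- K) < \<epsilon>))"

definition null_homologous :: "(int \<Rightarrow> real ^ 'd) measure \<Rightarrow> bool" where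
  "null_homologous P \<longleftrightarrow>
     (\<exists>Q. borel_prob_measure Q \<and> shift_invariant Q \<and> P = distr Q borel increments)"

end

theory Submission
  imports Defs
begin

text \<open>
  If \<open>P\<close> is the law of \<open>D y\<close> with \<open>y\<close> stationary, then \<open>S\<^sub>n\<close> telescopes to
  \<open>y\<^sub>n\<^sub>+\<^sub>1 - y\<^sub>1\<close>, a difference of two variables whose laws do not depend on \<open>n\<close>; hence
  tightness (\<open>null_homologous_imp_tight\<close>).

  For the converse no weak limits are taken. The stationary sequence \<open>y\<close> is obtained as an explicit
  function of the given sequence, and this works one coordinate at a time for any measure-preserving
  map \<open>T\<close> and any real function \<open>f\<close> whose Birkhoff sums
  \<open>S\<^sub>n = f + f \<circ> T + \<dots> + f \<circ> T\<^sup>n\<^sup>-\<^sup>1\<close> are tight: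
  there is a measurable \<open>u\<close> with \<open>u \<circ> T - u = f\<close> almost everywhere (\<open>tight_imp_coboundary\<close>).
  The reason is that \<open>S\<^sub>j(T x) = S\<^sub>j\<^sub>+\<^sub>1(x) - f x\<close>, so the orbits of partial sums seen from
  \<open>T x\<close> and from \<open>x\<close> differ by the translation by \<open>f x\<close> and by one initial term. Any location
  parameter \<open>m(x)\<close> of the sequence \<open>S\<^sub>0(x), S\<^sub>1(x), \<dots>\<close> that moves along with translations
  and ignores finitely many terms satisfies \<open>m(T x) = m(x) - f x\<close>, and \<open>u = - m\<close> solves the
  equation. An asymptotic median is such a parameter (\<open>median_T\<close>), provided that it is finite.

  Finiteness is the point where tightness enters, through a maximal inequality
  (\<open>prob_excursion_le\<close>): if \<open>\<bar>S\<^sub>j\<bar> > K\<close> has probability at most \<open>\<epsilon>\<close> for every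
  \<open>j\<close>, then with probability at least \<open>1 - 5 \<epsilon>\<close> no initial segment of
  \<open>S\<^sub>0, S\<^sub>1, \<dots>\<close> spends a quarter of its time outside \<open>[-2 K, 2 K]\<close>. Indeed, a segment
  that starts at a time \<open>i\<close> with \<open>\<bar>S\<^sub>i\<bar> \<le> K\<close> and moves more than \<open>2 K\<close> away from
  \<open>S\<^sub>i\<close> for a quarter of its length yields that many times at which \<open>\<bar>S\<^sub>j\<bar> > K\<close>;
  disjoint segments of this kind can be selected greedily (\<open>covering_count\<close>), and the times
  \<open>\<bar>S\<^sub>j\<bar> > K\<close> are rare on average.
\<close>

section \<open>A covering lemma for windows of integers\<close>

text \<open>
  Greedy selection from the left: at the first point of \<open>G\<close> use up its window, whose length is
  paid for by the weight \<open>b\<close> in it, and go on behind it. The selected windows are disjoint and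
  contain all of \<open>G\<close> below \<open>m\<close>; the last one may reach beyond \<open>m\<close> by less than \<open>N\<close>.
\<close>

lemma covering_count:
  fixes b :: "nat \<Rightarrow> real" and G :: "nat set"
  assumes b: "\<And>j. 0 \<le> b j"
    and window: "\<And>i. i \<in> G \<Longrightarrow> \<exists>n\<in>{1..N}. real n \<le> (\<Sum>j=i..<i + n. b j)"
  shows "real (card (G \<inter> {a..<m})) \<le> (\<Sum>j=a..<m + N. b j)"
proof (induction "m - a" arbitrary: a rule: less_induct)
  case less
  consider "m \<le> a" | "a < m" "a \<notin> G" | "a < m" "a \<in> G"
    by linarith
  then show ?case
  proof cases
    case 1
    then show ?thesis by (simp add: sum_nonneg b)
  next
    case 2
    then have "G \<inter> {a..<m} = G \<inter> {Suc a..<m}"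
      by (auto simp: Suc_le_eq order.strict_iff_order)
    moreover have "(\<Sum>j=Suc a..<m + N. b j) \<le> (\<Sum>j=a..<m + N. b j)"
      by (rule sum_mono2) (auto simp: b)
    moreover have "real (card (G \<inter> {Suc a..<m})) \<le> (\<Sum>j=Suc a..<m + N. b j)"
      using 2 by (intro less) auto
    ultimately show ?thesis
      by simp
  next
    case 3
    then obtain n where n: "1 \<le> n" "n \<le> N" "real n \<le> (\<Sum>j=a..<a + n. b j)"
      using window by force
    have "G \<inter> {a..<m} \<subseteq> {a..<a + n} \<union> G \<inter> {a + n..<m}"
      by auto
    then have "card (G \<inter> {a..<m}) \<le> card ({a..<a + n} \<union> G \<inter> {a + n..<m})"
      by (intro card_mono) auto
    also have "\<dots> \<le> n + card (G \<inter> {a + n..<m})"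
      using card_Un_le[of "{a..<a + n}"] by simp
    finally have "real (card (G \<inter> {a..<m})) \<le> real n + real (card (G \<inter> {a + n..<m}))"
      by linarith
    also have "\<dots> \<le> (\<Sum>j=a..<a + n. b j) + (\<Sum>j=a + n..<m + N. b j)"
      using n 3 by (intro add_mono less) auto
    also have "\<dots> = (\<Sum>j=a..<m + N. b j)"
      using n 3 by (intro sum.atLeastLessThan_concat) auto
    finally show ?thesis .
  qed
qed

section \<open>Tight Birkhoff sums come from coboundaries\<close>

locale cocycle = prob_space M for M :: "'a measure" +
  fixes T :: "'a \<Rightarrow> 'a" and f :: "'a \<Rightarrow> real"
  assumes T [measurable]: "T \<in> measurable M M"
    and T_invariant: "distr M M T = M"
    and f [measurable]: "f \<in> borel_measurable M"
begin

definition birkhoff :: "nat \<Rightarrow> 'a \<Rightarrow> real" where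
  "birkhoff n x = (\<Sum>i<n. f ((T ^^ i) x))"

lemma T_iterate [measurable]: "T ^^ i \<in> measurable M M"
  by (rule measurable_compose_n) measurable

lemma birkhoff_measurable [measurable]: "birkhoff n \<in> borel_measurable M"
  unfolding birkhoff_def by measurable

lemma birkhoff_add: "birkhoff (i + j) x = birkhoff i x + birkhoff j ((T ^^ i) x)"
proof (induction j)
  case (Suc j)
  have "(T ^^ (i + j)) x = (T ^^ j) ((T ^^ i) x)"
    by (simp add: add.commute[of i] funpow_add)
  with Suc show ?case
    by (simp add: birkhoff_def)
qed (simp add: birkhoff_def)

lemma birkhoff_Suc: "birkhoff (Suc j) x = f x + birkhoff j (T x)"
  using birkhoff_add[of 1 j x] by (simp add: birkhoff_def)

lemma distr_iterate: "distr M M (T ^^ i) = M"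
proof (induction i)
  case (Suc i)
  have "distr M M (T ^^ Suc i) = distr (distr M M (T ^^ i)) M T"
    by (simp add: distr_distr flip: funpow.simps)
  then show ?case
    by (simp only: Suc T_invariant)
qed (simp add: id_def distr_id)

lemma prob_iterate:
  assumes [measurable]: "A \<in> sets M"
  shows "prob {x \<in> space M. (T ^^ i) x \<in> A} = prob A"
proof -
  have "prob {x \<in> space M. (T ^^ i) x \<in> A} = measure (distr M M (T ^^ i)) A"
    by (subst measure_distr) (auto intro!: arg_cong[where f = prob])
  then show ?thesis
    by (simp add: distr_iterate)
qed

text \<open>
  The factor 4 demands that a quarter of the initial segment be far from the origin. A fraction below
  one half is what makes its absence bound the median on both sides.
\<close>

definition excursion :: "real \<Rightarrow> nat \<Rightarrow> 'a set" where
  "excursion r N = {x \<in> space M. \<exists>n\<in>{1..N}. real n \<le> (\<Sum>j<n. 4 * of_bool (r < \<bar>birkhoff j x\<bar>))}"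

lemma excursion_sets [measurable]: "excursion r N \<in> sets M"
  unfolding excursion_def by measurable

text \<open>
  The maximal inequality. On a long interval \<open>[0, m)\<close>, count the times \<open>i\<close> with \<open>\<bar>S\<^sub>i\<bar> \<le> K\<close>
  from which an excursion beyond \<open>2 K\<close> begins. By the covering lemma their number is at most four
  times the number of \<open>j < m + N\<close> with \<open>\<bar>S\<^sub>j\<bar> > K\<close>. Integrating and using stationarity gives
  \<open>m (p - \<epsilon>) \<le> 4 (m + N) \<epsilon>\<close> for the probability \<open>p\<close> of the excursion set, and
  \<open>m \<rightarrow> \<infinity>\<close> removes \<open>N\<close>.
\<close>

lemma prob_excursion_le:
  assumes tail: "\<And>j. prob {x \<in> space M. K < \<bar>birkhoff j x\<bar>} \<le> e"
  shows "prob (excursion (2 * K) N) \<le> 5 * e"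
proof -
  define A where "A = excursion (2 * K) N"
  have [measurable]: "A \<in> sets M"
    by (simp add: A_def)
  define far where "far j = {x \<in> space M. K < \<bar>birkhoff j x\<bar>}" for j
  define start where "start i = {x \<in> space M. (T ^^ i) x \<in> A} - far i" for i
  have [measurable]: "far i \<in> sets M" "start i \<in> sets M" for i
    unfolding far_def start_def by measurable
  have count: "(\<Sum>i<m. indicator (start i) x) \<le> (\<Sum>j<m + N. 4 * indicator (far j) x :: real)"
    if x: "x \<in> space M" for m x
  proof -
    have "real (card ({i. x \<in> start i} \<inter> {0..<m})) \<le> (\<Sum>j=0..<m + N. 4 * indicator (far j) x)"
    proof (rule covering_count)
      fix i assume "i \<in> {i. x \<in> start i}"
      then have i: "(T ^^ i) x \<in> A" "\<bar>birkhoff i x\<bar> \<le> K"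
        using x by (auto simp: start_def far_def)
      from i(1) obtain n where n: "n \<in> {1..N}"
        "real n \<le> (\<Sum>j<n. 4 * of_bool (2 * K < \<bar>birkhoff j ((T ^^ i) x)\<bar>))"
        by (auto simp: A_def excursion_def)
      (* Being more than 2K away from a point of [-K,K] means being outside [-K,K]. *)
      have "(\<Sum>j<n. 4 * of_bool (2 * K < \<bar>birkhoff j ((T ^^ i) x)\<bar>)) \<le> (\<Sum>j<n. 4 * indicator (far (i + j)) x :: real)"
        using i(2) x by (intro sum_mono) (auto simp: birkhoff_add far_def indicator_def)
      also have "\<dots> = (\<Sum>j=i..<i + n. 4 * indicator (far j) x)"
        using sum.shift_bounds_nat_ivl[of "\<lambda>j. 4 * indicator (far j) x :: real" 0 i n]
        by (simp add: atLeast0LessThan add.commute)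
      finally show "\<exists>n\<in>{1..N}. real n \<le> (\<Sum>j=i..<i + n. 4 * indicator (far j) x)"
        using n by force
    qed simp
    moreover have "real (card ({i. x \<in> start i} \<inter> {0..<m})) = (\<Sum>i<m. indicator (start i) x)"
      by (simp add: indicator_def sum.If_cases Int_commute atLeast0LessThan flip: of_bool_def)
    ultimately show ?thesis
      by (simp add: atLeast0LessThan)
  qed
  have bound: "real m * (prob A - e) \<le> 4 * (real m + real N) * e" for m
  proof -
    have "prob A - e \<le> prob (start i)" for i
    proof -
      have "prob A = prob {x \<in> space M. (T ^^ i) x \<in> A}"
        by (simp add: prob_iterate)
      also have "\<dots> \<le> prob (start i \<union> far i)"
        by (intro finite_measure_mono) (auto simp: start_def)
      also have "\<dots> \<le> prob (start i) + prob (far i)"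
        by (intro measure_Un_le) auto
      finally show ?thesis
        using tail[of i] by (simp add: far_def)
    qed
    then have "real m * (prob A - e) \<le> (\<Sum>i<m. prob (start i))"
      using sum_mono[of "{..<m}" "\<lambda>i. prob A - e"] by simp
    also have "\<dots> = (\<integral>x. (\<Sum>i<m. indicator (start i) x) \<partial>M)"
      by (simp add: less_top[symmetric])
    also have "\<dots> \<le> (\<integral>x. (\<Sum>j<m + N. 4 * indicator (far j) x) \<partial>M)"
      by (intro integral_mono count Bochner_Integration.integrable_sum) (auto simp: less_top[symmetric])
    also have "\<dots> = (\<Sum>j<m + N. \<integral>x. 4 * indicator (far j) x \<partial>M)"
      by (intro Bochner_Integration.integral_sum) (auto simp: less_top[symmetric])
    also have "\<dots> = (\<Sum>j<m + N. 4 * prob (far j))"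
      by (intro sum.cong) (auto simp: less_top[symmetric])
    also have "\<dots> \<le> (\<Sum>j<m + N. 4 * e)"
      using tail by (intro sum_mono) (simp add: far_def)
    finally show ?thesis by (simp add: algebra_simps)
  qed
  show ?thesis
  proof (rule ccontr)
    assume "\<not> ?thesis"
    then have "0 < prob A - 5 * e"
      by (simp add: A_def)
    then obtain m where "4 * real N * e < real m * (prob A - 5 * e)"
      using reals_Archimedean3 by blast
    then show False
      using bound[of m] by (simp add: algebra_simps)
  qed
qed

text \<open>
  More than half of the partial sums lie below \<open>t\<close>, in the sense that the excess over one half is
  unbounded along the orbit. Unboundedness, rather than positivity, makes the notion insensitive to
  dropping the initial term, which is what the passage from \<open>x\<close> to \<open>T x\<close> does.
\<close>

definition heavy :: "'a \<Rightarrow> real \<Rightarrow> bool" where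
  "heavy x t \<longleftrightarrow> (\<forall>C::nat. \<exists>n. real n / 2 + real C \<le> (\<Sum>j<n. of_bool (birkhoff j x \<le> t)))"

lemma heavy_measurable [measurable]: "Measurable.pred M (\<lambda>x. heavy x t)"
  unfolding heavy_def by measurable

lemma heavy_mono:
  assumes "heavy x s" and "s \<le> t"
  shows "heavy x t"
proof -
  have "(\<Sum>j<n. of_bool (birkhoff j x \<le> s)) \<le> (\<Sum>j<n. of_bool (birkhoff j x \<le> t) :: real)" for n
    using assms(2) by (intro sum_mono) auto
  with assms(1) show ?thesis
    unfolding heavy_def by (blast intro: order_trans)
qed

lemma heavy_T: "heavy (T x) t \<longleftrightarrow> heavy x (t + f x)"
proof -
  define c where "c n = (\<Sum>j<n. of_bool (birkhoff j x \<le> t + f x) :: real)" for n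
  have "(\<Sum>j<n. of_bool (birkhoff j (T x) \<le> t)) = (\<Sum>j<n. of_bool (birkhoff (Suc j) x \<le> t + f x) :: real)" for n
    by (intro sum.cong) (auto simp: birkhoff_Suc)
  also have "\<dots> n = c (Suc n) - c 1" for n
    unfolding c_def sum.lessThan_Suc_shift[of _ n] by simp
  finally have *: "(\<Sum>j<n. of_bool (birkhoff j (T x) \<le> t)) = c (Suc n) - c 1" for n .
  have c: "0 \<le> c 1" "c 1 \<le> 1" "c n \<le> c (Suc n)" "c (Suc n) \<le> c n + 1" for n
    by (simp_all add: c_def)
  show ?thesis
    unfolding heavy_def * unfolding c_def[symmetric]
  proof safe
    fix C :: nat
    assume "\<forall>C::nat. \<exists>n. real n / 2 + real C \<le> c (Suc n) - c 1"
    then obtain n where "real n / 2 + real (C + 1) \<le> c (Suc n) - c 1" by blast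
    then show "\<exists>n. real n / 2 + real C \<le> c n"
      using c(1) by (intro exI[of _ "Suc n"]) (simp add: field_simps)
  next
    fix C :: nat
    assume "\<forall>C::nat. \<exists>n. real n / 2 + real C \<le> c n"
    then obtain n where "real n / 2 + real (C + 1) \<le> c n" by blast
    then show "\<exists>n. real n / 2 + real C \<le> c (Suc n) - c 1"
      using c(2) c(3)[of n] by (intro exI[of _ n]) simp
  qed
qed

text \<open>
  The infimum is taken in the extended reals because that is where its measurability is immediate;
  it is meaningful only where it is finite, and is set to 0 elsewhere.
\<close>

definition median :: "'a \<Rightarrow> real" where
  "median x = real_of_ereal (INF t\<in>{t. heavy x t}. ereal t)"

lemma median_measurable [measurable]: "median \<in> borel_measurable M"
proof -
  have "(\<lambda>x. INF t\<in>{t. heavy x t}. ereal t) \<in> borel_measurable M"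
  proof (rule borel_measurableI_less)
    fix y :: ereal
    have "(INF t\<in>{t. heavy x t}. ereal t) < y \<longleftrightarrow> (\<exists>q::rat. ereal (of_rat q) < y \<and> heavy x (of_rat q))" for x
    proof
      assume "(INF t\<in>{t. heavy x t}. ereal t) < y"
      then obtain t where t: "heavy x t" "ereal t < y"
        by (auto simp: INF_less_iff)
      then obtain z where "ereal t < ereal z" "ereal z < y"
        using ereal_dense2 by blast
      then obtain q where "t < of_rat q" "real_of_rat q < z"
        using of_rat_dense[of t z] by auto
      with t \<open>ereal z < y\<close> show "\<exists>q::rat. ereal (of_rat q) < y \<and> heavy x (of_rat q)"
        by (meson heavy_mono ereal_less_eq(3) le_less_trans less_imp_le)
    qed (auto simp: INF_less_iff)
    then show "{x \<in> space M. (INF t\<in>{t. heavy x t}. ereal t) < y} \<in> sets M"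
      by simp
  qed
  then show ?thesis
    unfolding median_def by measurable
qed

text \<open>
  The hypotheses say that the median at \<open>x\<close> is finite. The set of heavy levels is translated by
  \<open>- f x\<close> when \<open>x\<close> is replaced by \<open>T x\<close>, and so is its infimum.
\<close>

lemma median_T:
  assumes "heavy x b" and "\<not> heavy x a"
  shows "median (T x) = median x - f x"
proof -
  have bound: "a \<le> t" if "heavy x t" for t
    using assms(2) heavy_mono[OF that, of a] by linarith
  have ne: "{t. heavy x t} \<noteq> {}" and bdd: "bdd_below {t. heavy x t}"
    using assms(1) bound by (auto intro!: bdd_belowI[of _ a])
  have T: "{t. heavy (T x) t} = (\<lambda>t. - f x + t) ` {t. heavy x t}"
  proof (intro equalityI subsetI)
    fix t assume "t \<in> {t. heavy (T x) t}"
    then show "t \<in> (\<lambda>t. - f x + t) ` {t. heavy x t}"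
      by (intro image_eqI[of _ _ "t + f x"]) (auto simp: heavy_T)
  qed (auto simp: heavy_T)
  have ne': "{t. heavy (T x) t} \<noteq> {}" and bdd': "bdd_below {t. heavy (T x) t}"
    using ne bound unfolding T by (auto intro!: bdd_belowI[of _ "a - f x"])
  have "median x = Inf {t. heavy x t}" "median (T x) = Inf {t. heavy (T x) t}"
    unfolding median_def ereal_Inf'[OF bdd ne, symmetric] ereal_Inf'[OF bdd' ne', symmetric] by simp_all
  moreover have "Inf ((\<lambda>t. - f x + t) ` {t. heavy x t}) = - f x + Inf {t. heavy x t}"
    by (rule Inf_add_eq[where f = "\<lambda>t. t", unfolded image_ident, OF bdd ne])
  ultimately show ?thesis
    by (simp add: T)
qed

text \<open>
  Without excursions, at least three quarters of the partial sums lie below \<open>r\<close>, so the excess over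
  one half grows like \<open>n / 4\<close>, and at most one quarter lie below \<open>- r - 1\<close>, so that the excess is
  never positive.
\<close>

lemma not_excursion_bounded:
  assumes "x \<in> space M" "\<And>N. x \<notin> excursion r N"
  shows "heavy x r" "\<not> heavy x (- r - 1)"
proof -
  have few: "4 * (\<Sum>j<n. of_bool (r < \<bar>birkhoff j x\<bar>)) \<le> real n" for n
  proof (cases "n = 0")
    case False
    then show ?thesis
      using assms(1) assms(2)[of n] unfolding excursion_def
      by (auto simp: sum_distrib_left not_le dest!: bspec[of _ _ n])
  qed simp
  have "real n \<le> (\<Sum>j<n. of_bool (birkhoff j x \<le> r)) + (\<Sum>j<n. of_bool (r < \<bar>birkhoff j x\<bar>))" for n
    unfolding sum.distrib[symmetric]
    by (rule order_trans[OF _ sum_mono[of _ "\<lambda>_. 1"]]) auto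
  with few have many: "3 * real n \<le> 4 * (\<Sum>j<n. of_bool (birkhoff j x \<le> r))" for n
    by (smt (verit))
  show "heavy x r"
    unfolding heavy_def
  proof
    fix C :: nat
    show "\<exists>n. real n / 2 + real C \<le> (\<Sum>j<n. of_bool (birkhoff j x \<le> r))"
      (* At n = 4C the margin of n/4 between three quarters and one half equals C. *)
      using many[of "4 * C"] by (intro exI[of _ "4 * C"]) simp
  qed
  have "(\<Sum>j<n. of_bool (birkhoff j x \<le> - r - 1)) \<le> (\<Sum>j<n. of_bool (r < \<bar>birkhoff j x\<bar>) :: real)" for n
    by (intro sum_mono) auto
  with few have "4 * (\<Sum>j<n. of_bool (birkhoff j x \<le> - r - 1)) \<le> real n" for n
    by (smt (verit))
  then have "\<not> real n / 2 + real 1 \<le> (\<Sum>j<n. of_bool (birkhoff j x \<le> - r - 1))" for n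
    by (smt (verit, best) field_sum_of_halves of_nat_0_le_iff of_nat_1)
  then show "\<not> heavy x (- r - 1)"
    unfolding heavy_def by blast
qed

text \<open>
  The tail bound \<open>1 / (5 (k + 1))\<close> turns the maximal inequality into the bound \<open>1 / (k + 1)\<close>
  for the set where excursions beyond \<open>2 K\<^sub>k\<close> occur. A point outside one of these sets has a finite
  median, and their intersection is null.
\<close>

theorem tight_imp_coboundary:
  assumes tight: "\<And>e. 0 < e \<Longrightarrow> \<exists>K. \<forall>n. prob {x \<in> space M. K < \<bar>birkhoff n x\<bar>} \<le> e"
  shows "\<exists>u \<in> borel_measurable M. AE x in M. u (T x) - u x = f x"
proof -
  have "\<exists>K. \<forall>n. prob {x \<in> space M. K < \<bar>birkhoff n x\<bar>} \<le> 1 / (5 * real (Suc k))" for k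
    by (intro tight) simp
  then obtain K where K: "\<And>k n. prob {x \<in> space M. K k < \<bar>birkhoff n x\<bar>} \<le> 1 / (5 * real (Suc k))"
    by metis
  define E where "E k = (\<Union>N. excursion (2 * K k) N)" for k
  have [measurable]: "E k \<in> sets M" for k
    unfolding E_def by measurable
  have E: "prob (E k) \<le> 1 / real (Suc k)" for k
  proof -
    have "incseq (excursion (2 * K k))"
      unfolding excursion_def by (intro incseq_SucI) force
    then have "(\<lambda>N. prob (excursion (2 * K k) N)) \<longlonglongrightarrow> prob (E k)"
      unfolding E_def by (intro finite_Lim_measure_incseq) auto
    moreover have "prob (excursion (2 * K k) N) \<le> 1 / real (Suc k)" for N
      using prob_excursion_le[OF K, of k N] by (simp add: field_simps)
    ultimately show ?thesis
      by (intro LIMSEQ_le_const2) auto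
  qed
  have "prob (\<Inter>k. E k) \<le> 1 / real (Suc k)" for k
    using finite_measure_mono[of "\<Inter>k. E k" "E k"] E[of k] by fastforce
  then have "prob (\<Inter>k. E k) \<le> 0"
    using LIMSEQ_le_const[OF LIMSEQ_inverse_real_of_nat] by (simp add: inverse_eq_divide)
  then have "(\<Inter>k. E k) \<in> null_sets M"
    by (auto simp: null_sets_def emeasure_eq_measure measure_le_0_iff)
  then have "AE x in M. x \<notin> (\<Inter>k. E k)"
    by (rule AE_not_in)
  then have "AE x in M. - median (T x) - (- median x) = f x"
    using AE_space
  proof eventually_elim
    case (elim x)
    then obtain k where k: "\<And>N. x \<notin> excursion (2 * K k) N"
      by (auto simp: E_def)
    have "median (T x) = median x - f x"
      by (rule median_T) (rule not_excursion_bounded[OF _ k], use elim in simp)+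
    then show ?case
      by simp
  qed
  then show ?thesis
    by (intro bexI[of _ "\<lambda>x. - median x"]) auto
qed

end

section \<open>Shifts by arbitrary integers on sequence space\<close>

definition translate :: "int \<Rightarrow> (int \<Rightarrow> 'a) \<Rightarrow> (int \<Rightarrow> 'a)" where
  "translate n x = (\<lambda>k. x (k + n))"

lemma translate_translate: "translate m (translate n x) = translate (m + n) x"
  by (simp add: translate_def algebra_simps)

lemma shift_eq_translate: "shift = translate 1"
  by (auto simp: translate_def shift_def)

lemma shift_translate: "shift (translate n x) = translate (n + 1) x"
  by (simp add: shift_eq_translate translate_translate add.commute)

lemma translate_shift: "translate n (shift x) = translate (n + 1) x"
  by (simp add: shift_eq_translate translate_translate)

lemma funpow_shift: "(shift ^^ i) x = translate (int i) x"
  by (induction i) (simp_all add: shift_translate add.commute, simp add: translate_def)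

lemma translate_measurable [measurable]:
  "(translate n :: (int \<Rightarrow> real ^ 'd) \<Rightarrow> _) \<in> borel_measurable borel"
  unfolding translate_def
  by (intro borel_measurable_continuous_onI continuous_on_coordinatewise_then_product
      continuous_on_product_coordinates)

lemma entry_measurable [measurable]: "(\<lambda>x :: int \<Rightarrow> real ^ 'd. x n $ c) \<in> borel_measurable borel"
  by (intro borel_measurable_continuous_onI continuous_on_component
      continuous_on_product_coordinates)

lemma coordinate_measurable [measurable]: "(\<lambda>x :: int \<Rightarrow> real ^ 'd. x n) \<in> borel_measurable borel"
  by (intro borel_measurable_continuous_onI continuous_on_product_coordinates)

lemma measurable_vec_lambda:
  fixes f :: "'d::finite \<Rightarrow> 'a \<Rightarrow> real"
  assumes "\<And>c. f c \<in> borel_measurable M"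
  shows "(\<lambda>x. \<chi> c. f c x) \<in> borel_measurable M"
proof (rule borel_measurable_euclidean_space[THEN iffD2], rule ballI)
  fix i :: "real ^ 'd"
  assume "i \<in> Basis"
  then obtain c where "i = axis c 1"
    by (auto simp: Basis_vec_def)
  then show "(\<lambda>x. (\<chi> c. f c x) \<bullet> i) \<in> borel_measurable M"
    using assms by (simp add: inner_axis)
qed

text \<open>
  Negative translations are included: they invert iterates of the shift, so invariance passes to them.
  This is what allows a function on sequence space to be evaluated along whole two-sided orbits.
\<close>

lemma distr_translate:
  fixes P :: "(int \<Rightarrow> real ^ 'd) measure"
  assumes sets: "sets P = sets borel" and inv: "shift_invariant P"
  shows "distr P borel (translate n) = P"
proof -
  have [measurable_cong]: "sets P = sets borel" by (rule sets)
  have id: "distr P borel (translate 0) = P"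
    unfolding translate_def by (simp add: distr_id2[OF sets[symmetric]])
  have step: "distr P borel (translate (k + 1)) = distr P borel (translate k)" for k
  proof -
    have "distr P borel (translate k) = distr (distr P borel shift) borel (translate k)"
      using inv by (simp add: shift_invariant_def)
    also have "\<dots> = distr P borel (translate k \<circ> shift)"
      by (rule distr_distr) (auto simp: shift_eq_translate)
    also have "translate k \<circ> shift = translate (k + 1)"
      by (auto simp: translate_shift)
    finally show ?thesis by simp
  qed
  show ?thesis
  proof (induction n rule: int_induct[where k = 0])
    case (step2 i)
    then show ?case using step[of "i - 1"] by simp
  qed (simp_all add: id step)
qed

section \<open>Null-homologous laws and tight partial sums\<close>

lemma tight_family_sequence:
  fixes \<mu> :: "nat \<Rightarrow> 'a::t2_space measure"
  shows "tight_family {\<mu> n | n. n \<ge> 0} \<longleftrightarrow>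
    (\<forall>n. borel_prob_measure (\<mu> n)) \<and>
    (\<forall>e>0. \<exists>K. compact K \<and> (\<forall>n. measure (\<mu> n) (- K) < e))"
proof -
  have "{\<mu> n | n. n \<ge> 0} = range \<mu>"
    by auto
  then show ?thesis
    by (simp add: tight_family_def)
qed

lemma partial_sum_increments: "partial_sum n (increments y) = y (int n + 1) - y 1"
  by (induction n) (simp_all add: partial_sum_def increments_def shift_def add.commute)

text \<open>
  By telescoping, \<open>\<bar>S\<^sub>n\<bar> > 2 k\<close> forces \<open>\<bar>y\<^sub>n\<^sub>+\<^sub>1\<bar> > k\<close> or \<open>\<bar>y\<^sub>1\<bar> > k\<close>, and by
  stationarity both events have the probability of \<open>\<bar>y\<^sub>0\<bar> > k\<close>.
\<close>

lemma null_homologous_imp_tight: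
  fixes P :: "(int \<Rightarrow> real ^ 'd) measure"
  assumes "null_homologous P"
  shows "tight_family {distr P borel (partial_sum n) | n. n \<ge> 0}"
proof -
  obtain Q where Q: "prob_space Q" "sets Q = sets borel" "shift_invariant Q"
    and P: "P = distr Q borel increments"
    using assms by (auto simp: null_homologous_def borel_prob_measure_def)
  interpret Q: prob_space Q by fact
  have [measurable_cong]: "sets Q = sets borel" by fact
  note [measurable] = increments_measurable partial_sum_measurable
  have space_Q: "space Q = UNIV"
    using sets_eq_imp_space_eq[OF Q(2)] by simp
  have law: "distr P borel (partial_sum n) = distr Q borel (\<lambda>y. y (int n + 1) - y 1)" for n
    by (simp add: P distr_distr comp_def partial_sum_increments)
  define tail where "tail r n = {y \<in> space Q. r < norm (y n)}" for r :: real and n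
  have [measurable]: "tail r n \<in> sets Q" for r n
    unfolding tail_def by measurable
  have tail: "Q.prob (tail r n) = Q.prob (tail r 0)" for r n
  proof -
    have "Q.prob (tail r 0) = measure (distr Q borel (translate n)) (tail r 0)"
      by (simp add: distr_translate Q)
    also have "\<dots> = Q.prob (tail r n)"
      by (subst measure_distr) (auto intro!: arg_cong[where f = Q.prob] simp: tail_def translate_def space_Q)
    finally show ?thesis by simp
  qed
  have "\<exists>K. compact K \<and> (\<forall>n. measure (distr P borel (partial_sum n)) (- K) < e)" if "0 < e" for e
  proof -
    have "(\<lambda>k. Q.prob (tail (real k) 0)) \<longlonglongrightarrow> Q.prob (\<Inter>k. tail (real k) 0)"
      by (intro Q.finite_Lim_measure_decseq) (auto simp: decseq_def tail_def)
    moreover have "(\<Inter>k. tail (real k) 0) = {}"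
      by (auto simp: tail_def) (meson less_asym reals_Archimedean2)
    ultimately have "(\<lambda>k. Q.prob (tail (real k) 0)) \<longlonglongrightarrow> 0"
      by simp
    then have "\<forall>\<^sub>F k in sequentially. Q.prob (tail (real k) 0) < e / 2"
      using that by (intro order_tendstoD) auto
    then obtain k where k: "Q.prob (tail (real k) 0) < e / 2"
      by (auto simp: eventually_sequentially)
    have "measure (distr P borel (partial_sum n)) (- cball 0 (2 * real k)) < e" for n
    proof -
      have "measure (distr P borel (partial_sum n)) (- cball 0 (2 * real k))
          = Q.prob {y \<in> space Q. 2 * real k < norm (y (int n + 1) - y 1)}"
        unfolding law by (subst measure_distr) (auto intro!: arg_cong[where f = Q.prob])
      also have "\<dots> \<le> Q.prob (tail k (int n + 1) \<union> tail k 1)"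
      proof (intro Q.finite_measure_mono subsetI)
        fix y assume "y \<in> {y \<in> space Q. 2 * real k < norm (y (int n + 1) - y 1)}"
        then show "y \<in> tail k (int n + 1) \<union> tail k 1"
          using norm_triangle_ineq4[of "y (int n + 1)" "y 1"] by (auto simp: tail_def)
      qed auto
      also have "\<dots> \<le> Q.prob (tail k (int n + 1)) + Q.prob (tail k 1)"
        by (intro measure_Un_le) auto
      finally show ?thesis
        using k tail[of k "int n + 1"] tail[of k 1] by simp
    qed
    then show ?thesis
      using compact_cball by blast
  qed
  moreover have "borel_prob_measure (distr P borel (partial_sum n))" for n
    by (auto simp: borel_prob_measure_def law intro!: Q.prob_space_distr)
  ultimately show ?thesis
    unfolding tight_family_sequence by blast
qed

text \<open>
  Each coordinate of \<open>x\<^sub>1\<close> is a coboundary \<open>u \<circ> T - u\<close> of the shift, because its Birkhoff sums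
  are the corresponding coordinates of \<open>S\<^sub>n\<close>. Evaluating \<open>u\<close> along the two-sided orbit of
  \<open>x\<close> gives a sequence that depends on \<open>x\<close> shift-equivariantly and has increments \<open>x\<close>; its
  law is the required \<open>Q\<close>.
\<close>

lemma tight_imp_null_homologous:
  fixes P :: "(int \<Rightarrow> real ^ 'd) measure"
  assumes P: "borel_prob_measure P" and inv: "shift_invariant P"
    and tight: "tight_family {distr P borel (partial_sum n) | n. n \<ge> 0}"
  shows "null_homologous P"
proof -
  interpret prob_space P
    using P by (simp add: borel_prob_measure_def)
  have sets_P [measurable_cong]: "sets P = sets borel"
    using P by (simp add: borel_prob_measure_def)
  note [measurable] = increments_measurable partial_sum_measurable shift_measurable
  have "distr P P shift = distr P borel shift"
    by (rule distr_cong) (simp_all add: sets_P)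
  with inv have distr_shift: "distr P P shift = P"
    by (simp only: shift_invariant_def)
  have "\<exists>u \<in> borel_measurable P. AE x in P. u (shift x) - u x = x 1 $ c" for c
  proof -
    interpret cocycle P shift "\<lambda>x. x 1 $ c"
    proof
      show "distr P P shift = P"
        by (rule distr_shift)
    qed measurable
    have birkhoff: "birkhoff n x = partial_sum n x $ c" for n x
      unfolding birkhoff_def partial_sum_def
      by (simp add: funpow_shift translate_def sum.atLeast1_atMost_eq add.commute)
    show ?thesis
    proof (rule tight_imp_coboundary)
      fix e :: real assume "0 < e"
      then obtain K where K: "compact K" "\<And>n. measure (distr P borel (partial_sum n)) (- K) < e"
        using tight unfolding tight_family_sequence by blast
      then obtain r where r: "\<And>s. s \<in> K \<Longrightarrow> norm s \<le> r"
        using compact_imp_bounded bounded_iff by metis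
      have "prob {x \<in> space P. r < \<bar>birkhoff n x\<bar>} \<le> e" for n
      proof -
        have [measurable]: "K \<in> sets borel"
          using K(1) by (intro borel_compact)
        have "prob {x \<in> space P. r < \<bar>birkhoff n x\<bar>} \<le> prob (partial_sum n -` (- K) \<inter> space P)"
        proof (intro finite_measure_mono subsetI)
          fix x assume "x \<in> {x \<in> space P. r < \<bar>birkhoff n x\<bar>}"
          then have "x \<in> space P" "r < norm (partial_sum n x)"
            using component_le_norm_cart[of "partial_sum n x" c] by (auto simp: birkhoff)
          then show "x \<in> partial_sum n -` (- K) \<inter> space P"
            using r by fastforce
        qed measurable
        also have "\<dots> = measure (distr P borel (partial_sum n)) (- K)"
          by (subst measure_distr) auto
        finally show ?thesis
          using K(2)[of n] by simp
      qed
      then show "\<exists>r. \<forall>n. prob {x \<in> space P. r < \<bar>birkhoff n x\<bar>} \<le> e"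
        by blast
    qed
  qed
  then have "\<forall>c. \<exists>u. u \<in> borel_measurable P \<and> (AE x in P. u (shift x) - u x = x 1 $ c)"
    by blast
  from choice[OF this] obtain u where u [measurable]: "\<And>c. u c \<in> borel_measurable P"
    and u_shift: "\<And>c. AE x in P. u c (shift x) - u c x = x 1 $ c"
    by blast
  (* The index is n - 1 because the coboundary of u at x is the entry of x at 1, not at 0. *)
  define W where "W x = (\<lambda>n. \<chi> c. u c (translate (n - 1) x))" for x
  have [measurable]: "W \<in> borel_measurable P"
    unfolding W_def
    by (intro measurable_coordinatewise_then_product measurable_vec_lambda) measurable
  have W_shift: "W (shift x) = shift (W x)" for x
    by (simp add: W_def translate_shift shift_def[of "\<lambda>n. \<chi> c. u c (translate (n - 1) x)"])
  have "AE x in P. \<forall>c n. u c (translate n x) - u c (translate (n - 1) x) = x n $ c"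
  proof -
    have "AE x in P. u c (translate n x) - u c (translate (n - 1) x) = x n $ c" for c n
    proof -
      have "AE x in distr P borel (translate (n - 1)). u c (shift x) - u c x = x 1 $ c"
        unfolding distr_translate[OF sets_P inv] by (rule u_shift)
      then have "AE x in P. u c (shift (translate (n - 1) x)) - u c (translate (n - 1) x) = translate (n - 1) x 1 $ c"
        by (rule AE_distrD[rotated]) measurable
      then show ?thesis
        by (simp add: shift_translate) (simp add: translate_def)
    qed
    then show ?thesis
      by (simp add: AE_all_countable)
  qed
  then have increments_W: "AE x in P. increments (W x) = x"
    by eventually_elim (auto simp: increments_def shift_def W_def vec_eq_iff)
  show ?thesis
    unfolding null_homologous_def
  proof (intro exI conjI)
    show "borel_prob_measure (distr P borel W)"
      by (auto simp: borel_prob_measure_def intro!: prob_space_distr)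
    have "distr (distr P borel W) borel shift = distr P borel (\<lambda>x. W (shift x))"
      by (subst distr_distr) (auto simp: comp_def W_shift)
    also have "\<dots> = distr (distr P P shift) borel W"
      by (subst distr_distr) (auto simp: comp_def)
    also have "distr P P shift = P"
      by (rule distr_shift)
    finally show "shift_invariant (distr P borel W)"
      by (simp add: shift_invariant_def)
    have "P = distr P borel (\<lambda>x. x)"
      by (simp add: distr_id2 sets_P)
    also have "\<dots> = distr P borel (\<lambda>x. increments (W x))"
      using increments_W by (intro distr_cong_AE) auto
    also have "\<dots> = distr (distr P borel W) borel increments"
      by (subst distr_distr) (auto simp: comp_def)
    finally show "P = distr (distr P borel W) borel increments" .
  qed
qed

theorem theorem2p2:
  fixes P :: "(int \<Rightarrow> real ^ 'd) measure"
  assumes "borel_prob_measure P" and "shift_invariant P"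
  shows "tight_family {distr P borel (partial_sum n) | n. n \<ge> 0} \<longleftrightarrow> null_homologous P"
  using assms tight_imp_null_homologous null_homologous_imp_tight by blast

end
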